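(* Let $m \geq 4$ and let $G \in ER(n,d,m+1)$ have a uniform shared neighborhood structure. Then this uniform shared neighborhood structure is not isomorphic to the wheel graph $W_m$.
   Context: The wheel graph $W_m$ is the graph on $m+1$ vertices in which $m$ vertices induce a cycle $C_m$ and the remaining vertex is adjacent to all vertices of the cycle. For a finite simple graph $G$, $N(u)$ is the open neighborhood of $u$. $G \in ER(n,d,\lambda)$ means $G$ has $n$ vertices, is $d$-regular, and every pair of adjacent vertices has exactly $\lambda$ common neighbors. $G$ has a uniform shared neighborhood structure isomorphic to $H$ if the induced subgraph $G[N(u)\cap N(v)]$ is isomorphic to $H$ for all adjacent $u,v$.
   Formalization: The graph G is additionally assumed to have at least one edge; for an edgeless G every condition holds vacuously for any H, including the wheel, so "this uniform shared neighborhood structure" would be undefined. *)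

theory Defs
  imports "Graph_Theory.Graph_Theory"
begin

text \<open>
  Finite simple graphs are the finite, loop-free, symmetric digraphs without parallel arcs of
  \<^locale>\<open>pair_graph\<close>: an edge between \<open>u\<close> and \<open>v\<close> is the pair of arcs \<open>(u, v)\<close>, \<open>(v, u)\<close>.
\<close>

definition nbhd :: "'a pair_pre_digraph \<Rightarrow> 'a \<Rightarrow> 'a set" where
  "nbhd G u = {v. (u, v) \<in> parcs G}"

text \<open>As literally defined, \<open>ER n d l\<close> contains edgeless graphs (for every \<open>l\<close>).\<close>

definition ER :: "nat \<Rightarrow> nat \<Rightarrow> nat \<Rightarrow> 'a pair_pre_digraph set" where
  "ER n d l = {G. pair_graph G
     \<and> card (pverts G) = n
     \<and> (\<forall>v \<in> pverts G. out_degree (with_proj G) v = d)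
     \<and> (\<forall>u v. (u, v) \<in> parcs G \<longrightarrow> card (nbhd G u \<inter> nbhd G v) = l)}"

definition has_uniform_shared_nbhd :: "'a pair_pre_digraph \<Rightarrow> 'b pair_pre_digraph \<Rightarrow> bool" where
  "has_uniform_shared_nbhd G H \<longleftrightarrow>
     (\<forall>u v. (u, v) \<in> parcs G \<longrightarrow>
        digraph_iso (with_proj G \<restriction> (nbhd G u \<inter> nbhd G v)) (with_proj H))"

text \<open>The cycle on \<open>0, \<dots>, m - 1\<close>; meaningful for \<open>m \<ge> 3\<close>.\<close>

definition cycle_graph :: "nat \<Rightarrow> nat pair_pre_digraph" where
  "cycle_graph m = \<lparr> pverts = {..<m},
     parcs = {(i, j). i < m \<and> j < m \<and> (j = Suc i mod m \<or> i = Suc j mod m)} \<rparr>"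

text \<open>The hub is the vertex \<open>m\<close>.\<close>

definition wheel_graph :: "nat \<Rightarrow> nat pair_pre_digraph" where
  "wheel_graph m = \<lparr> pverts = {..m},
     parcs = parcs (cycle_graph m) \<union> {m} \<times> {..<m} \<union> {..<m} \<times> {m} \<rparr>"

lemma pair_graph_wheel_graph:
  assumes "m \<ge> 3"
  shows "pair_graph (wheel_graph m)"
proof -
  have sub: "parcs (wheel_graph m) \<subseteq> {..m} \<times> {..m}"
    by (auto simp: wheel_graph_def cycle_graph_def)
  have loop: "Suc i mod m \<noteq> i" if "i < m" for i
    using that assms by (cases "Suc i = m") auto
  show ?thesis
  proof
    show "finite (parcs (wheel_graph m))"
      using sub by (rule finite_subset) simp
  qed (use loop loop[symmetric] in \<open>auto simp: wheel_graph_def cycle_graph_def symmetric_def sym_def\<close>)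
qed

lemma wheel_graph_rim:
  "with_proj (wheel_graph m) \<restriction> {..<m} = with_proj (cycle_graph m)"
  by (auto simp: induce_subgraph_def with_proj_def wheel_graph_def cycle_graph_def)

end

theory Submission
  imports Defs
begin

text \<open>
  Let \<open>u v\<close> be an edge, let \<open>w\<close> be the hub of the wheel on \<open>N(u) \<inter> N(v)\<close> and \<open>c\<close> a rim vertex whose
  rim neighbours are \<open>y\<close> and \<open>z\<close>. The wheel on \<open>N(u) \<inter> N(w)\<close> contains \<open>v\<close> and the rim of the first
  wheel, so by counting it consists of nothing else. Hence in the wheel on \<open>N(u) \<inter> N(c)\<close> the vertices
  \<open>v\<close> and \<open>w\<close> both have degree 3, with neighbours \<open>w, y, z\<close> and \<open>v, y, z\<close>. As \<open>m \<ge> 4\<close>, neither of them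
  is the hub of that wheel, so the hub is \<open>y\<close> or \<open>z\<close>; but then \<open>y\<close> and \<open>z\<close> are adjacent, which is
  impossible for the two rim neighbours of \<open>c\<close>.
\<close>

text \<open>Library isomorphisms act on vertices and on arcs. Only adjacency matters below, so the
  arc map is dropped here.\<close>

lemma digraph_isoE:
  assumes "digraph_iso G H"
  obtains f where "bij_betw f (verts G) (verts H)"
    and "\<And>x y. x \<in> verts G \<Longrightarrow> y \<in> verts G \<Longrightarrow> (x, y) \<in> arcs_ends G \<longleftrightarrow> (f x, f y) \<in> arcs_ends H"
proof -
  obtain k where k: "pre_digraph.digraph_isomorphism G k" and H: "H = app_iso k G"
    using assms by (auto simp: digraph_iso_def)
  then interpret wf_digraph G
    by (simp add: pre_digraph.digraph_isomorphism_def)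
  have inj: "inj_on (iso_verts k) (verts G)"
    using k by (rule digraph_isomorphism_inj_on_verts)
  have ends: "arcs_ends H = (\<lambda>a. (iso_verts k (tail G a), iso_verts k (head G a))) ` arcs G"
    using k by (auto simp: arcs_ends_def arc_to_ends_def H iso_verts_tail iso_verts_head image_iff)
  show thesis
  proof (rule that[of "iso_verts k"])
    show "bij_betw (iso_verts k) (verts G) (verts H)"
      using inj by (simp add: bij_betw_def H)
  next
    fix x y assume "x \<in> verts G" "y \<in> verts G"
    then show "(x, y) \<in> arcs_ends G \<longleftrightarrow> (iso_verts k x, iso_verts k y) \<in> arcs_ends H"
      unfolding ends using inj by (auto simp: arcs_ends_def arc_to_ends_def image_iff inj_on_eq_iff)
  qed
qed

text \<open>The witnesses are the cyclic successor and predecessor of \<open>i\<close>. They are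
  non-adjacent because \<open>m \<ge> 4\<close>; for \<open>m = 3\<close> the rim would be a
  triangle.\<close>

lemma wheel_graph_rim_neighbours:
  assumes "m \<ge> 4" "i < m"
  obtains a b where "a < m" "b < m" "a \<noteq> b" "(a, b) \<notin> parcs (wheel_graph m)"
    and "\<And>j. (i, j) \<in> parcs (wheel_graph m) \<longleftrightarrow> j = m \<or> j = a \<or> j = b"
proof
  show "(if Suc i = m then 0 else Suc i) < m" "(if i = 0 then m - 1 else i - 1) < m"
    "(if Suc i = m then 0 else Suc i) \<noteq> (if i = 0 then m - 1 else i - 1)"
    "(if Suc i = m then 0 else Suc i, if i = 0 then m - 1 else i - 1) \<notin> parcs (wheel_graph m)"
    using assms by (auto simp: wheel_graph_def cycle_graph_def mod_Suc)
  show "(i, j) \<in> parcs (wheel_graph m) \<longleftrightarrow>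
      j = m \<or> j = (if Suc i = m then 0 else Suc i) \<or> j = (if i = 0 then m - 1 else i - 1)" for j
    using assms by (auto simp: wheel_graph_def cycle_graph_def mod_Suc)
qed

text \<open>Pulls hub and rim back along \<open>f\<close>: \<open>h\<close> is the preimage of the
  hub \<open>m\<close>, and \<open>y\<close>, \<open>z\<close> are the preimages of the two rim
  neighbours of \<open>f x\<close>.\<close>

lemma induced_wheel_structure:
  assumes "m \<ge> 4"
    and f: "bij_betw f S {..m}"
    and adj: "\<And>x y. x \<in> S \<Longrightarrow> y \<in> S \<Longrightarrow>
      (x, y) \<in> parcs G \<longleftrightarrow> (f x, f y) \<in> parcs (wheel_graph m)"
  obtains h where "h \<in> S" "\<And>x. x \<in> S - {h} \<Longrightarrow> (h, x) \<in> parcs G"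
    and "\<And>x. x \<in> S - {h} \<Longrightarrow>
      \<exists>y z. y \<noteq> z \<and> y \<noteq> h \<and> z \<noteq> h \<and> (y, z) \<notin> parcs G \<and> nbhd G x \<inter> S = {h, y, z}"
proof -
  have pre: "\<exists>x\<in>S. f x = i" if "i \<le> m" for i
    using bij_betw_imp_surj_on[OF f] that by (metis atMost_iff imageE)
  have inj: "f x = f y \<longleftrightarrow> x = y" if "x \<in> S" "y \<in> S" for x y
    using bij_betw_imp_inj_on[OF f] that by (simp add: inj_on_eq_iff)
  have le: "f x \<le> m" if "x \<in> S" for x
    using bij_betwE[OF f] that by auto
  obtain h where h: "h \<in> S" "f h = m"
    using pre by blast
  have lt: "f x < m" if "x \<in> S - {h}" for x
    using that le[of x] inj[of x h] h by auto
  show thesis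
  proof (rule that)
    show "h \<in> S" by (rule h)
  next
    fix x assume x: "x \<in> S - {h}"
    then show "(h, x) \<in> parcs G"
      using lt[OF x] h by (auto simp: adj wheel_graph_def)
    obtain a b where ab: "a < m" "b < m" "a \<noteq> b" "(a, b) \<notin> parcs (wheel_graph m)"
      "\<And>j. (f x, j) \<in> parcs (wheel_graph m) \<longleftrightarrow> j = m \<or> j = a \<or> j = b"
      using wheel_graph_rim_neighbours[OF \<open>m \<ge> 4\<close> lt[OF x]] by metis
    obtain y z where yz: "y \<in> S" "f y = a" "z \<in> S" "f z = b"
      using pre[of a] pre[of b] ab(1,2) by auto
    have "w \<in> nbhd G x \<inter> S \<longleftrightarrow> w \<in> {h, y, z}" for w
    proof (cases "w \<in> S")
      case True
      then have "w \<in> nbhd G x \<longleftrightarrow> f w = m \<or> f w = a \<or> f w = b"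
        using x by (simp add: nbhd_def adj ab(5))
      then show ?thesis
        using True inj[OF True] h yz by auto
    qed (use h yz in auto)
    moreover have "y \<noteq> z" "y \<noteq> h" "z \<noteq> h" "(y, z) \<notin> parcs G"
      using ab yz h adj by auto
    ultimately show "\<exists>y z. y \<noteq> z \<and> y \<noteq> h \<and> z \<noteq> h \<and> (y, z) \<notin> parcs G \<and> nbhd G x \<inter> S = {h, y, z}"
      by blast
  qed
qed

theorem theorem6:
  fixes G :: "'a pair_pre_digraph" and H :: "'b pair_pre_digraph" and n d m :: nat
  assumes "m \<ge> 4"
    and "G \<in> ER n d (m + 1)"
    and "parcs G \<noteq> {}"
    and "has_uniform_shared_nbhd G H"
  shows "\<not> digraph_iso (with_proj H) (with_proj (wheel_graph m))"
proof
  assume iso: "digraph_iso (with_proj H) (with_proj (wheel_graph m))"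
  interpret pair_graph G
    using assms(2) by (simp add: ER_def)
  have card_nbhd: "card (nbhd G u \<inter> nbhd G v) = m + 1" if "(u, v) \<in> parcs G" for u v
    using assms(2) that by (simp add: ER_def)
  \<comment> \<open>Infinite sets have cardinality 0, so the positive value \<open>m + 1\<close>
    forces finiteness.\<close>
  have fin: "finite (nbhd G u \<inter> nbhd G v)" if "(u, v) \<in> parcs G" for u v
    using card_nbhd[OF that] by (intro card_ge_0_finite) simp
  have sym: "(y, x) \<in> parcs G" if "(x, y) \<in> parcs G" for x y
    using that by (rule arcs_symmetric)
  have irrefl: "(x, x) \<notin> parcs G" for x
    using no_loops[of "(x, x)"] by auto
  have wheel: "\<exists>h \<in> nbhd G u \<inter> nbhd G v.
      (\<forall>x \<in> nbhd G u \<inter> nbhd G v - {h}. (h, x) \<in> parcs G \<and>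
        (\<exists>y z. y \<noteq> z \<and> y \<noteq> h \<and> z \<noteq> h \<and> (y, z) \<notin> parcs G \<and>
          nbhd G x \<inter> (nbhd G u \<inter> nbhd G v) = {h, y, z}))"
    if uv: "(u, v) \<in> parcs G" for u v
  proof -
    let ?S = "nbhd G u \<inter> nbhd G v"
    have "digraph_iso (with_proj G \<restriction> ?S) (with_proj H)"
      using assms(4) uv by (simp add: has_uniform_shared_nbhd_def)
    then obtain f where f: "bij_betw f ?S (pverts H)"
      "\<And>x y. x \<in> ?S \<Longrightarrow> y \<in> ?S \<Longrightarrow> (x, y) \<in> parcs G \<longleftrightarrow> (f x, f y) \<in> parcs H"
      by (elim digraph_isoE) (auto simp: arcs_ends_def arc_to_ends_def)
    obtain g where g: "bij_betw g (pverts H) {..m}"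
      "\<And>x y. x \<in> pverts H \<Longrightarrow> y \<in> pverts H \<Longrightarrow>
        (x, y) \<in> parcs H \<longleftrightarrow> (g x, g y) \<in> parcs (wheel_graph m)"
      using iso by (elim digraph_isoE) (auto simp: arcs_ends_def arc_to_ends_def wheel_graph_def)
    have "bij_betw (g \<circ> f) ?S {..m}"
      using f(1) g(1) by (rule bij_betw_trans)
    moreover have "(x, y) \<in> parcs G \<longleftrightarrow> ((g \<circ> f) x, (g \<circ> f) y) \<in> parcs (wheel_graph m)"
      if "x \<in> ?S" "y \<in> ?S" for x y
      using that f(2) g(2) bij_betwE[OF f(1)] by simp
    ultimately show ?thesis
      by (rule induced_wheel_structure[OF \<open>m \<ge> 4\<close>]) blast+
  qed
  \<comment> \<open>For an edgeless graph the uniformity condition is vacuous; the assumption that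
    \<open>G\<close> has an edge enters here.\<close>
  obtain u v where uv: "(u, v) \<in> parcs G"
    using assms(3) by auto
  define S where "S = nbhd G u \<inter> nbhd G v"
  obtain w where w: "w \<in> S" "\<And>x. x \<in> S - {w} \<Longrightarrow> (w, x) \<in> parcs G"
    and rim: "\<And>x. x \<in> S - {w} \<Longrightarrow>
      \<exists>y z. y \<noteq> z \<and> y \<noteq> w \<and> z \<noteq> w \<and> (y, z) \<notin> parcs G \<and> nbhd G x \<inter> S = {w, y, z}"
    using wheel[OF uv] unfolding S_def by blast
  have S: "finite S" "card S = m + 1"
    using fin[OF uv] card_nbhd[OF uv] by (auto simp: S_def)
  have "S - {w} \<noteq> {}"
    using S w(1) \<open>m \<ge> 4\<close>
    by (metis add_diff_cancel_right' card.empty card_Diff_singleton not_numeral_le_zero)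
  then obtain c where c: "c \<in> S - {w}" by blast
  obtain y z where yz: "y \<noteq> z" "y \<noteq> w" "z \<noteq> w" "(y, z) \<notin> parcs G" "nbhd G c \<inter> S = {w, y, z}"
    using rim[OF c] by blast
  have uw: "(u, w) \<in> parcs G" and vw: "(v, w) \<in> parcs G" and uc: "(u, c) \<in> parcs G"
    and vc: "(v, c) \<in> parcs G"
    using w(1) c by (auto simp: S_def nbhd_def)
  have "insert v (S - {w}) = nbhd G u \<inter> nbhd G w"
  proof (rule card_subset_eq)
    show "insert v (S - {w}) \<subseteq> nbhd G u \<inter> nbhd G w"
      using uv sym[OF vw] w(2) by (auto simp: S_def nbhd_def)
    \<comment> \<open>Exchanging \<open>w\<close> for the new element \<open>v\<close> keeps the
      cardinality at \<open>m + 1\<close>.\<close>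
    have "v \<notin> S"
      using irrefl by (auto simp: S_def nbhd_def)
    then show "card (insert v (S - {w})) = card (nbhd G u \<inter> nbhd G w)"
      using S w(1) card_nbhd[OF uw] by simp
  qed (rule fin[OF uw])
  \<comment> \<open>Intersect the equality just proved with \<open>nbhd G c\<close>: of the vertices
    \<open>w, y, z\<close> of \<open>S\<close> adjacent to \<open>c\<close>, \<open>w\<close> is
    exchanged for \<open>v\<close>.\<close>
  then have w_nbrs: "nbhd G u \<inter> nbhd G c \<inter> nbhd G w = {v, y, z}"
    using yz(2,3,5) sym[OF vc] by (auto simp: nbhd_def)
  have v_nbrs: "nbhd G u \<inter> nbhd G c \<inter> nbhd G v = {w, y, z}"
    using yz(5) by (auto simp: S_def)
  define T where "T = nbhd G u \<inter> nbhd G c"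
  obtain h where h: "h \<in> T" "\<And>x. x \<in> T - {h} \<Longrightarrow> (h, x) \<in> parcs G"
    using wheel[OF uc] unfolding T_def by blast
  have hub_degree: "card (T \<inter> nbhd G h) = m"
  proof -
    have "T \<inter> nbhd G h = T - {h}"
      using h irrefl by (auto simp: nbhd_def)
    then show ?thesis
      using h(1) card_nbhd[OF uc] by (simp add: T_def)
  qed
  \<comment> \<open>At most 3 neighbours inside \<open>T\<close> are too few for a hub, which has
    \<open>m \<ge> 4\<close>; this excludes both \<open>v\<close> and \<open>w\<close>.\<close>
  have small: "card {p, y, z} < m" for p
    using card_length[of "[p, y, z]"] \<open>m \<ge> 4\<close> by simp
  have "h \<noteq> v" "h \<noteq> w"
    using hub_degree small[of w] small[of v] v_nbrs w_nbrs by (auto simp: T_def)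
  moreover have "v \<in> T" "y \<in> T" "z \<in> T"
    using v_nbrs w_nbrs by (auto simp: T_def)
  \<comment> \<open>The hub \<open>h\<close> is adjacent to \<open>v \<in> T\<close>, so it is one
    of the neighbours \<open>w, y, z\<close> of \<open>v\<close> in \<open>T\<close>.\<close>
  ultimately have "h = y \<or> h = z"
    using v_nbrs h sym[of h v] by (auto simp: T_def nbhd_def)
  then show False
    using h(2) sym yz(1,4) \<open>y \<in> T\<close> \<open>z \<in> T\<close> by blast
qed

end
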